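(* Let $G$ be a locally compact group, let $(A,\alpha)$ be a w-proper action of $G$ on a $C^*$-algebra $A$, let $\pi$ be a representation of $A$ on a Hilbert space $H$, and for each $s\in G$ suppose we have a unitary operator $U_s$ on $H$ such that $\operatorname{Ad} U_s\circ\pi=\pi\circ\alpha_s$, i.e., $U_s\pi(a)U_s^*=\pi(\alpha_s(a))$ for all $a\in A$. Then for all $\xi,\eta\in H$ the function $s\mapsto \langle U_s\xi,\eta\rangle$ on $G$ vanishes at infinity.
   Context: An action $(A,\alpha)$ of $G$ is a homomorphism $\alpha$ from $G$ to the automorphism group of $A$ such that $s\mapsto\alpha_s(a)$ is norm continuous for each $a\in A$. It is w-proper if for all $a\in A$ and all $\omega\in A^*$ the function $s\mapsto \omega(\alpha_s(a))$ is in $C_0(G)$. A representation of $A$ on $H$ is a $*$-homomorphism from $A$ to the bounded operators on $H$. The map $s\mapsto U_s$ is not required to be a homomorphism. A function $h:G\to\mathbb C$ vanishes at infinity if for every $\epsilon>0$ there is a compact $K\subset G$ with $|h(s)|<\epsilon$ for all $s\in G\setminus K$.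
   Formalization: The representation π is additionally assumed nondegenerate (the closed linear span of π(A)H is H); without this the claim fails, e.g. for π = 0, U_s = 1 on H = ℂ and G noncompact. *)

theory Defs
  imports "HOL-Analysis.Analysis"
begin

section \<open>Complex normed and Hilbert spaces, C*-algebras\<close>

class scaleC = scaleR +
  fixes scaleC :: "complex \<Rightarrow> 'a \<Rightarrow> 'a" (infixr \<open>*\<^sub>C\<close> 75)
  assumes scaleR_scaleC: "r *\<^sub>R x = complex_of_real r *\<^sub>C x"

class complex_normed_vector = scaleC + real_normed_vector +
  assumes scaleC_add_right: "c *\<^sub>C (x + y) = c *\<^sub>C x + c *\<^sub>C y"
    and scaleC_add_left: "(c + d) *\<^sub>C x = c *\<^sub>C x + d *\<^sub>C x"
    and scaleC_scaleC: "c *\<^sub>C d *\<^sub>C x = (c * d) *\<^sub>C x"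
    and scaleC_one: "1 *\<^sub>C x = x"
    and norm_scaleC: "norm (c *\<^sub>C x) = cmod c * norm x"

instantiation complex :: complex_normed_vector
begin

definition scaleC_complex :: "complex \<Rightarrow> complex \<Rightarrow> complex"
  where "scaleC_complex c x = c * x"

instance
  by standard (auto simp: scaleC_complex_def scaleR_conv_of_real algebra_simps norm_mult)

end

text \<open>The inner product is linear in the first variable and conjugate-linear in the second.\<close>

class complex_hilbert_space = complex_normed_vector + complete_space +
  fixes cinner :: "'a \<Rightarrow> 'a \<Rightarrow> complex"
  assumes cinner_add_left: "cinner (x + y) z = cinner x z + cinner y z"
    and cinner_scaleC_left: "cinner (c *\<^sub>C x) y = c * cinner x y"
    and cinner_commute: "cinner x y = cnj (cinner y x)"
    and cinner_ge_zero: "0 \<le> Re (cinner x x)"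
    and norm_eq_sqrt_cinner: "norm x = sqrt (Re (cinner x x))"

text \<open>
  C*-algebras need not be unital; submultiplicativity of the norm is part of
  \<^class>\<open>real_normed_algebra\<close>.
\<close>

class cstar_algebra = complex_normed_vector + real_normed_algebra + complete_space +
  fixes star :: "'a \<Rightarrow> 'a"
  assumes scaleC_mult_left: "(c *\<^sub>C x) * y = c *\<^sub>C (x * y)"
    and scaleC_mult_right: "x * (c *\<^sub>C y) = c *\<^sub>C (x * y)"
    and star_add: "star (x + y) = star x + star y"
    and star_scaleC: "star (c *\<^sub>C x) = cnj c *\<^sub>C star x"
    and star_mult: "star (x * y) = star y * star x"
    and star_star: "star (star x) = x"
    and cstar_identity: "norm (star x * x) = (norm x)\<^sup>2"


section \<open>Bounded operators, functionals and representations\<close>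

definition bounded_clinear ::
    "('a::complex_normed_vector \<Rightarrow> 'b::complex_normed_vector) \<Rightarrow> bool"
  where "bounded_clinear f \<longleftrightarrow> bounded_linear f \<and> (\<forall>c x. f (c *\<^sub>C x) = c *\<^sub>C f x)"

definition dual_space :: "('a::complex_normed_vector \<Rightarrow> complex) set"
  where "dual_space = {\<omega>. bounded_clinear \<omega>}"

definition is_cadjoint ::
    "('h::complex_hilbert_space \<Rightarrow> 'h) \<Rightarrow> ('h \<Rightarrow> 'h) \<Rightarrow> bool"
  where "is_cadjoint T S \<longleftrightarrow>
    bounded_clinear S \<and> (\<forall>\<xi> \<eta>. cinner (T \<xi>) \<eta> = cinner \<xi> (S \<eta>))"

definition cadjoint :: "('h::complex_hilbert_space \<Rightarrow> 'h) \<Rightarrow> 'h \<Rightarrow> 'h"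
  where "cadjoint T = (THE S. is_cadjoint T S)"

definition unitary_operator :: "('h::complex_hilbert_space \<Rightarrow> 'h) \<Rightarrow> bool"
  where "unitary_operator U \<longleftrightarrow>
    bounded_clinear U \<and> (\<exists>V. is_cadjoint U V \<and> V \<circ> U = id \<and> U \<circ> V = id)"

definition representation ::
    "('a::cstar_algebra \<Rightarrow> 'h::complex_hilbert_space \<Rightarrow> 'h) \<Rightarrow> bool"
  where "representation \<pi> \<longleftrightarrow>
    (\<forall>a. bounded_clinear (\<pi> a)) \<and>
    (\<forall>a b \<xi>. \<pi> (a + b) \<xi> = \<pi> a \<xi> + \<pi> b \<xi>) \<and>
    (\<forall>c a \<xi>. \<pi> (c *\<^sub>C a) \<xi> = c *\<^sub>C \<pi> a \<xi>) \<and>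
    (\<forall>a b. \<pi> (a * b) = \<pi> a \<circ> \<pi> b) \<and>
    (\<forall>a. is_cadjoint (\<pi> a) (\<pi> (star a)))"

text \<open>
  A \<^emph>\<open>representation\<close> may be degenerate (for instance zero), in which case a unitary
  implementation \<open>U\<close> is not constrained at all on the orthogonal complement of the essential
  subspace; statements about arbitrary vectors therefore need nondegeneracy separately.
  The set of all vectors \<open>\<pi> a \<xi>\<close> is closed under complex scalars, so its real span
  is its complex span.
\<close>

definition nondegenerate ::
    "('a::cstar_algebra \<Rightarrow> 'h::complex_hilbert_space \<Rightarrow> 'h) \<Rightarrow> bool"
  where "nondegenerate \<pi> \<longleftrightarrow> closure (span {\<pi> a \<xi> | a \<xi>. True}) = UNIV"


section \<open>Actions of locally compact groups\<close>

text \<open>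
  Groups are written additively, as in \<^class>\<open>topological_group_add\<close>;
  they are not assumed to be commutative.
\<close>

class locally_compact_group = topological_group_add + t2_space +
  assumes compact_neighbourhood: "\<exists>V K. open V \<and> x \<in> V \<and> V \<subseteq> K \<and> compact K"

definition vanishes_at_infinity :: "('g::topological_space \<Rightarrow> complex) \<Rightarrow> bool"
  where "vanishes_at_infinity h \<longleftrightarrow>
    (\<forall>\<epsilon>>0. \<exists>K. compact K \<and> (\<forall>s. s \<notin> K \<longrightarrow> cmod (h s) < \<epsilon>))"

definition C0 :: "('g::topological_space \<Rightarrow> complex) set"
  where "C0 = {h. continuous_on UNIV h \<and> vanishes_at_infinity h}"

definition cstar_automorphism :: "('a::cstar_algebra \<Rightarrow> 'a) \<Rightarrow> bool"
  where "cstar_automorphism f \<longleftrightarrow>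
    bij f \<and>
    (\<forall>a b. f (a + b) = f a + f b) \<and>
    (\<forall>c a. f (c *\<^sub>C a) = c *\<^sub>C f a) \<and>
    (\<forall>a b. f (a * b) = f a * f b) \<and>
    (\<forall>a. f (star a) = star (f a))"

definition group_action ::
    "('g::locally_compact_group \<Rightarrow> 'a::cstar_algebra \<Rightarrow> 'a) \<Rightarrow> bool"
  where "group_action \<alpha> \<longleftrightarrow>
    (\<forall>s. cstar_automorphism (\<alpha> s)) \<and>
    (\<forall>s t. \<alpha> (s + t) = \<alpha> s \<circ> \<alpha> t) \<and>
    (\<forall>a. continuous_on UNIV (\<lambda>s. \<alpha> s a))"

definition w_proper ::
    "('g::locally_compact_group \<Rightarrow> 'a::cstar_algebra \<Rightarrow> 'a) \<Rightarrow> bool"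
  where "w_proper \<alpha> \<longleftrightarrow> (\<forall>a. \<forall>\<omega>\<in>dual_space. (\<lambda>s. \<omega> (\<alpha> s a)) \<in> C0)"

end

theory Submission
  imports Defs
begin

text \<open>
  For a vector of the form \<open>\<pi> a \<xi>\<close> the covariance relation moves \<open>U s\<close> past \<open>\<pi> a\<close>, and
  Cauchy-Schwarz gives
  \<open>\<bar>\<langle>U s (\<pi> a \<xi>), \<eta>\<rangle>\<bar> = \<bar>\<langle>U s \<xi>, \<pi> (\<alpha> s (star a)) \<eta>\<rangle>\<bar> \<le> \<parallel>\<xi>\<parallel> \<cdot> \<parallel>\<pi> (\<alpha> s (star a)) \<eta>\<parallel>\<close>.
  The square of the last norm is \<open>\<omega> (\<alpha> s (a * star a))\<close>, where \<open>\<omega>\<close> is the vector functional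
  \<open>b \<mapsto> \<langle>\<pi> b \<eta>, \<eta>\<rangle>\<close>; w-properness says that it tends to zero.
  The vectors whose coefficients against \<open>\<eta>\<close> vanish at infinity form a closed subspace,
  because the operators \<open>U s\<close> are isometric, so nondegeneracy extends the conclusion to all of \<open>H\<close>.

  The point that needs work is that \<open>\<omega>\<close> is a \<^emph>\<open>bounded\<close> functional, that is, that
  *-representations are automatically contractive (\<open>representation_contractive\<close>). Instead of
  spectral theory, the proof solves \<open>(1 - y)\<^sup>2 = 1 - x\<close> for self-adjoint \<open>x\<close> of norm less than one
  by the contraction principle (\<open>selfadjoint_quadratic_solution\<close>); the unit is only formal
  there, so that nonunital algebras are covered.
\<close>

section \<open>The inner product\<close>

lemma cinner_add_right:
  "cinner x (y + z) = cinner x y + cinner x (z :: 'h::complex_hilbert_space)"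
  by (metis cinner_add_left cinner_commute complex_cnj_add)

lemma cinner_diff_left:
  "cinner (x - y) z = cinner x z - cinner y (z :: 'h::complex_hilbert_space)"
  by (metis cinner_add_left add_diff_cancel_right' diff_add_cancel)

lemma cinner_diff_right:
  "cinner x (y - z) = cinner x y - cinner x (z :: 'h::complex_hilbert_space)"
  by (metis cinner_add_right add_diff_cancel_right' diff_add_cancel)

lemma cinner_zero_left: "cinner 0 (y :: 'h::complex_hilbert_space) = 0"
  using cinner_diff_left[of 0 0 y] by simp

lemma cinner_zero_right: "cinner (x :: 'h::complex_hilbert_space) 0 = 0"
  using cinner_diff_right[of x 0 0] by simp

lemma cinner_scaleC_right:
  "cinner x (c *\<^sub>C y) = cnj c * cinner x (y :: 'h::complex_hilbert_space)"
  by (metis cinner_scaleC_left cinner_commute complex_cnj_mult)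

lemma cinner_scaleR_left:
  "cinner (r *\<^sub>R x) y = of_real r * cinner x (y :: 'h::complex_hilbert_space)"
  by (simp add: scaleR_scaleC cinner_scaleC_left)

lemma cinner_self: "cinner x x = of_real ((norm (x :: 'h::complex_hilbert_space))\<^sup>2)"
proof -
  have "Im (cinner x x) = - Im (cinner x x)"
    using arg_cong[OF cinner_commute[of x x], of Im] by simp
  then show ?thesis
    by (simp add: complex_eq_iff norm_eq_sqrt_cinner cinner_ge_zero)
qed

lemma Re_cinner_self: "Re (cinner x x) = (norm (x :: 'h::complex_hilbert_space))\<^sup>2"
  by (simp only: cinner_self Re_complex_of_real)

lemma norm_diff_sq:
  fixes x y :: "'h::complex_hilbert_space"
  shows "(norm (x - y))\<^sup>2 = (norm x)\<^sup>2 - 2 * Re (cinner y x) + (norm y)\<^sup>2"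
proof -
  have "Re (cinner x y) = Re (cinner y x)"
    using arg_cong[OF cinner_commute[of x y], of Re] by simp
  then show ?thesis
    unfolding Re_cinner_self[symmetric] by (simp add: cinner_diff_left cinner_diff_right)
qed

lemma cinner_Cauchy_Schwarz:
  fixes x y :: "'h::complex_hilbert_space"
  shows "cmod (cinner x y) \<le> norm x * norm y"
proof (cases "y = 0")
  case True
  then show ?thesis by (simp add: cinner_zero_right)
next
  case False
  define n where "n = (norm y)\<^sup>2"
  have n: "n > 0" using False by (simp add: n_def)
  \<comment> \<open>a multiple of the component of \<open>x\<close> orthogonal to \<open>y\<close>, scaled to avoid division\<close>
  let ?z = "of_real n *\<^sub>C x - cinner x y *\<^sub>C y"
  have "cinner ?z ?z = of_real n * (of_real n * cinner x x - cinner x y * cnj (cinner x y))"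
    using cinner_self[of y] cinner_commute[of y x]
    by (simp add: cinner_diff_left cinner_diff_right cinner_scaleC_left cinner_scaleC_right
        n_def algebra_simps)
  also have "\<dots> = of_real (n * (n * (norm x)\<^sup>2 - (cmod (cinner x y))\<^sup>2))"
    by (simp only: cinner_self complex_norm_square[symmetric] of_real_mult of_real_diff)
  finally have "Re (cinner ?z ?z) = n * (n * (norm x)\<^sup>2 - (cmod (cinner x y))\<^sup>2)"
    by (simp only: Re_complex_of_real)
  with cinner_ge_zero[of ?z] have "0 \<le> n * (n * (norm x)\<^sup>2 - (cmod (cinner x y))\<^sup>2)"
    by simp
  with n have "(cmod (cinner x y))\<^sup>2 \<le> (norm x * norm y)\<^sup>2"
    by (simp add: zero_le_mult_iff n_def power_mult_distrib mult.commute)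
  then show ?thesis
    by (rule power2_le_imp_le) simp
qed

section \<open>Adjoints and unitaries\<close>

lemma is_cadjoint_unique:
  fixes T :: "'h::complex_hilbert_space \<Rightarrow> 'h"
  assumes "is_cadjoint T S" "is_cadjoint T S'"
  shows "S = S'"
proof
  fix \<eta>
  have "cinner (S \<eta> - S' \<eta>) (S \<eta> - S' \<eta>) = 0"
    using assms unfolding is_cadjoint_def
    by (metis cinner_diff_right cancel_comm_monoid_add_class.diff_cancel)
  then show "S \<eta> = S' \<eta>"
    by (simp add: cinner_self)
qed

lemma cadjoint_eqI: "is_cadjoint T S \<Longrightarrow> cadjoint T = S"
  unfolding cadjoint_def using is_cadjoint_unique by blast

lemma unitary_operator_cadjoint:
  assumes "unitary_operator U"
  shows "cadjoint U (U \<xi>) = \<xi>"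
  using assms unfolding unitary_operator_def
  by (metis cadjoint_eqI comp_apply id_apply)

lemma unitary_operator_norm:
  assumes "unitary_operator U"
  shows "norm (U \<xi>) = norm \<xi>"
proof -
  from assms obtain V where V: "is_cadjoint U V" "V \<circ> U = id"
    unfolding unitary_operator_def by blast
  have "cinner (U \<xi>) (U \<xi>) = cinner \<xi> \<xi>"
    using V unfolding is_cadjoint_def by (metis comp_apply id_apply)
  then show ?thesis
    by (simp add: norm_eq_sqrt_cinner)
qed

lemma unitary_operator_linear: "unitary_operator U \<Longrightarrow> linear U"
  unfolding unitary_operator_def bounded_clinear_def by (simp add: bounded_linear.linear)

section \<open>Representations are contractive\<close>

lemma norm_star: "norm (star (x :: 'a::cstar_algebra)) = norm x"
proof -
  have le: "norm z \<le> norm (star z)" for z :: 'a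
  proof (cases "z = 0")
    case False
    have "norm z * norm z \<le> norm (star z) * norm z"
      using cstar_identity[of z] norm_mult_ineq[of "star z" z] by (simp add: power2_eq_square)
    with False show ?thesis by simp
  qed simp
  from le[of x] le[of "star x"] show ?thesis by (simp add: star_star)
qed

lemma star_scaleR: "star (r *\<^sub>R x) = r *\<^sub>R star (x :: 'a::cstar_algebra)"
  by (simp add: scaleR_scaleC star_scaleC)

lemma bounded_linear_star: "bounded_linear (star :: 'a::cstar_algebra \<Rightarrow> 'a)"
  by (rule bounded_linear_intro[where K = 1]) (auto simp: star_add star_scaleR norm_star)

text \<open>
  In the unitization the equation reads \<open>(1 - y)\<^sup>2 = 1 - x\<close>. The map \<open>y \<mapsto> (x + y\<^sup>2)/2\<close> preserves the
  ball of radius \<open>norm x\<close> and is Lipschitz there with constant \<open>norm x < 1\<close>; running the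
  iteration inside the self-adjoint elements makes the fixed point self-adjoint.
\<close>

lemma selfadjoint_quadratic_solution:
  fixes x :: "'a::cstar_algebra"
  assumes "star x = x" "norm x < 1"
  obtains y where "star y = y" "x = 2 *\<^sub>R y - y * y"
proof -
  define r where "r = norm x"
  define S where "S = {y :: 'a. star y = y} \<inter> cball 0 r"
  define f where "f y = (1/2) *\<^sub>R (x + y * y)" for y
  have r: "0 \<le> r" "r < 1" using assms by (auto simp: r_def)
  have "closed {y :: 'a. star y = y}"
    by (intro closed_Collect_eq bounded_linear.continuous_on[OF bounded_linear_star]
        continuous_on_id)
  then have "complete S"
    unfolding S_def complete_eq_closed by blast
  moreover have "S \<noteq> {}"
    using assms by (auto simp: S_def r_def)
  moreover have "f ` S \<subseteq> S"
  proof safe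
    fix y assume "y \<in> S"
    then have y: "star y = y" "norm y \<le> r" by (auto simp: S_def)
    have "norm (y * y) \<le> r * r"
      using y(2) norm_mult_ineq[of y y] mult_mono[of "norm y" r "norm y" r] r by simp
    also have "\<dots> \<le> r" using r mult_left_le[of r r] by simp
    finally have "norm (x + y * y) \<le> 2 * r"
      using norm_triangle_ineq[of x "y * y"] by (simp add: r_def)
    then show "f y \<in> S"
      using y(1) assms(1) by (simp add: S_def f_def star_scaleR star_add star_mult)
  qed
  moreover have "dist (f y) (f z) \<le> r * dist y z" if "y \<in> S \<and> z \<in> S" for y z
  proof -
    have yz: "norm y \<le> r" "norm z \<le> r" using that by (auto simp: S_def)
    have "norm (y * (y - z)) \<le> r * norm (y - z)"
      using norm_mult_ineq[of y "y - z"] mult_right_mono[OF yz(1), of "norm (y - z)"] by simp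
    moreover have "norm ((y - z) * z) \<le> r * norm (y - z)"
      using norm_mult_ineq[of "y - z" z] mult_left_mono[OF yz(2), of "norm (y - z)"]
      by (simp add: mult.commute)
    ultimately have "norm (y * (y - z) + (y - z) * z) \<le> 2 * (r * norm (y - z))"
      using norm_triangle_ineq[of "y * (y - z)" "(y - z) * z"] by simp
    moreover have "f y - f z = (1/2) *\<^sub>R (y * (y - z) + (y - z) * z)"
      by (simp add: f_def algebra_simps)
    ultimately show ?thesis by (simp add: dist_norm)
  qed
  ultimately have "\<exists>!y\<in>S. f y = y"
    using r by (intro Banach_fix[where c = r]) auto
  then obtain y where y: "y \<in> S" "f y = y" by blast
  have "2 *\<^sub>R y = x + y * y"
    by (subst y(2)[symmetric]) (simp add: f_def)
  with y(1) show thesis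
    by (intro that[of y]) (auto simp: S_def)
qed

lemma representation_linear:
  assumes "representation \<pi>"
  shows "linear (\<lambda>b. \<pi> b \<xi>)"
  using assms unfolding representation_def by (intro linearI) (auto simp: scaleR_scaleC)

lemma representation_norm_sq:
  assumes "representation \<pi>"
  shows "cinner (\<pi> (star b * b) \<xi>) \<xi> = of_real ((norm (\<pi> b \<xi>))\<^sup>2)"
proof -
  have "cinner (\<pi> (star b * b) \<xi>) \<xi> = cinner (\<pi> (star b) (\<pi> b \<xi>)) \<xi>"
    using assms unfolding representation_def by simp
  also have "\<dots> = cinner (\<pi> b \<xi>) (\<pi> b \<xi>)"
    using assms unfolding representation_def is_cadjoint_def by (metis star_star)
  finally show ?thesis by (simp only: cinner_self)
qed

text \<open>
  For \<open>norm b < 1\<close>, writing \<open>star b * b = 2 y - y\<^sup>2\<close> turns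
  \<open>\<parallel>\<xi>\<parallel>\<^sup>2 - \<parallel>\<pi> b \<xi>\<parallel>\<^sup>2\<close> into the square \<open>\<parallel>\<xi> - \<pi> y \<xi>\<parallel>\<^sup>2\<close>.
\<close>

lemma representation_norm_le_of_norm_less_1:
  assumes \<pi>: "representation \<pi>" and b: "norm b < 1"
  shows "norm (\<pi> b \<xi>) \<le> norm \<xi>"
proof -
  note lin = representation_linear[OF \<pi>, of \<xi>]
  have "norm (star b * b) < 1"
    using b by (simp add: cstar_identity power_less_one_iff abs_square_less_1)
  then obtain y where y: "star y = y" "star b * b = 2 *\<^sub>R y - y * y"
    using selfadjoint_quadratic_solution[of "star b * b"] by (auto simp: star_mult star_star)
  have "\<pi> (star b * b) \<xi> = 2 *\<^sub>R \<pi> y \<xi> - \<pi> (star y * y) \<xi>"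
    by (simp add: y linear_diff[OF lin] linear_scale[OF lin])
  then have "cinner (\<pi> (star b * b) \<xi>) \<xi>
      = 2 * cinner (\<pi> y \<xi>) \<xi> - cinner (\<pi> (star y * y) \<xi>) \<xi>"
    by (simp add: cinner_diff_left cinner_scaleR_left)
  then have "complex_of_real ((norm (\<pi> b \<xi>))\<^sup>2)
      = 2 * cinner (\<pi> y \<xi>) \<xi> - of_real ((norm (\<pi> y \<xi>))\<^sup>2)"
    by (simp only: representation_norm_sq[OF \<pi>])
  from arg_cong[OF this, of Re]
  have "(norm (\<pi> b \<xi>))\<^sup>2 = 2 * Re (cinner (\<pi> y \<xi>) \<xi>) - (norm (\<pi> y \<xi>))\<^sup>2"
    by (simp del: of_real_power)
  also have "\<dots> = (norm \<xi>)\<^sup>2 - (norm (\<xi> - \<pi> y \<xi>))\<^sup>2"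
    by (simp add: norm_diff_sq)
  finally have "(norm (\<pi> b \<xi>))\<^sup>2 \<le> (norm \<xi>)\<^sup>2" by simp
  then show ?thesis by (rule power2_le_imp_le) simp
qed

lemma representation_contractive:
  assumes "representation \<pi>"
  shows "norm (\<pi> b \<xi>) \<le> norm b * norm \<xi>"
proof (cases "\<xi> = 0")
  case True
  have "\<pi> b 0 = 0"
    using assms unfolding representation_def bounded_clinear_def
    by (meson bounded_linear.linear linear_0)
  with True show ?thesis by simp
next
  case False
  have "norm (\<pi> b \<xi>) / norm \<xi> \<le> t" if "norm b < t" for t
  proof -
    have t: "0 < t" using that norm_ge_zero[of b] by linarith
    then have "norm ((1/t) *\<^sub>R b) < 1" using that by simp
    from representation_norm_le_of_norm_less_1[OF assms this]
    have "norm ((1/t) *\<^sub>R \<pi> b \<xi>) \<le> norm \<xi>"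
      by (simp add: linear_scale[OF representation_linear[OF assms]])
    with t False show ?thesis by (simp add: field_simps)
  qed
  then have "norm (\<pi> b \<xi>) / norm \<xi> \<le> norm b" by (rule dense_ge)
  with False show ?thesis by (simp add: field_simps)
qed

lemma vector_functional_in_dual_space:
  assumes "representation \<pi>"
  shows "(\<lambda>b. cinner (\<pi> b \<xi>) \<eta>) \<in> dual_space"
proof -
  note lin = representation_linear[OF assms, of \<xi>]
  have "bounded_linear (\<lambda>b. cinner (\<pi> b \<xi>) \<eta>)"
  proof (rule bounded_linear_intro[where K = "norm \<xi> * norm \<eta>"])
    fix b
    have "cmod (cinner (\<pi> b \<xi>) \<eta>) \<le> norm (\<pi> b \<xi>) * norm \<eta>"
      by (rule cinner_Cauchy_Schwarz)
    also have "\<dots> \<le> norm b * norm \<xi> * norm \<eta>"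
      by (intro mult_right_mono representation_contractive[OF assms]) simp
    finally show "cmod (cinner (\<pi> b \<xi>) \<eta>) \<le> norm b * (norm \<xi> * norm \<eta>)"
      by (simp add: mult.assoc)
  qed (auto simp: linear_add[OF lin] linear_scale[OF lin] cinner_add_left cinner_scaleR_left
      scaleR_conv_of_real)
  moreover have "cinner (\<pi> (c *\<^sub>C b) \<xi>) \<eta> = c *\<^sub>C cinner (\<pi> b \<xi>) \<eta>" for c b
    using assms unfolding representation_def by (simp add: cinner_scaleC_left scaleC_complex_def)
  ultimately show ?thesis
    by (simp add: dual_space_def bounded_clinear_def)
qed

section \<open>Coefficients vanishing at infinity\<close>

lemma vanishes_at_infinityD:
  assumes "vanishes_at_infinity h" "\<epsilon> > 0"
  obtains K where "compact K" "\<And>s. s \<notin> K \<Longrightarrow> cmod (h s) < \<epsilon>"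
  using assms unfolding vanishes_at_infinity_def by blast

lemma vanishes_at_infinity_zero: "vanishes_at_infinity (\<lambda>s. 0)"
  unfolding vanishes_at_infinity_def by (auto intro: exI[of _ "{}"])

lemma vanishes_at_infinity_add:
  assumes "vanishes_at_infinity f" "vanishes_at_infinity g"
  shows "vanishes_at_infinity (\<lambda>s. f s + g s)"
  unfolding vanishes_at_infinity_def
proof (intro allI impI)
  fix \<epsilon> :: real assume "\<epsilon> > 0"
  then have e2: "\<epsilon>/2 > 0" by simp
  obtain K where K: "compact K" "\<And>s. s \<notin> K \<Longrightarrow> cmod (f s) < \<epsilon>/2"
    using vanishes_at_infinityD[OF assms(1) e2] by blast
  obtain L where L: "compact L" "\<And>s. s \<notin> L \<Longrightarrow> cmod (g s) < \<epsilon>/2"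
    using vanishes_at_infinityD[OF assms(2) e2] by blast
  have "cmod (f s + g s) < \<epsilon>" if "s \<notin> K \<union> L" for s
    using K(2)[of s] L(2)[of s] norm_triangle_ineq[of "f s" "g s"] that by auto
  with K(1) L(1) show "\<exists>K. compact K \<and> (\<forall>s. s \<notin> K \<longrightarrow> cmod (f s + g s) < \<epsilon>)"
    by (meson compact_Un)
qed

lemma vanishes_at_infinity_sq_dominated:
  assumes "vanishes_at_infinity g" and le: "\<And>s. (cmod (f s))\<^sup>2 \<le> c * cmod (g s)"
  shows "vanishes_at_infinity f"
  unfolding vanishes_at_infinity_def
proof (intro allI impI)
  fix \<epsilon> :: real assume e: "\<epsilon> > 0"
  define C where "C = \<bar>c\<bar> + 1"
  have C: "C > 0" "c \<le> C" by (auto simp: C_def)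
  have "\<epsilon>\<^sup>2 / C > 0" using e C by simp
  then obtain K where K: "compact K" "\<And>s. s \<notin> K \<Longrightarrow> cmod (g s) < \<epsilon>\<^sup>2 / C"
    using vanishes_at_infinityD[OF assms(1)] by blast
  have "cmod (f s) < \<epsilon>" if "s \<notin> K" for s
  proof -
    have "(cmod (f s))\<^sup>2 \<le> C * cmod (g s)"
      using le[of s] mult_right_mono[OF C(2), of "cmod (g s)"] by simp
    also have "\<dots> < \<epsilon>\<^sup>2"
      using K(2)[OF that] C(1) by (simp add: field_simps)
    finally show ?thesis using e by (simp add: power_less_imp_less_base)
  qed
  with K(1) show "\<exists>K. compact K \<and> (\<forall>s. s \<notin> K \<longrightarrow> cmod (f s) < \<epsilon>)" by blast
qed

lemma vanishes_at_infinity_scale: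
  assumes "vanishes_at_infinity f"
  shows "vanishes_at_infinity (\<lambda>s. c * f s)"
proof (cases "c = 0")
  case False
  show ?thesis
    unfolding vanishes_at_infinity_def
  proof (intro allI impI)
    fix \<epsilon> :: real assume "\<epsilon> > 0"
    then have "\<epsilon> / cmod c > 0" using False by simp
    then obtain K where "compact K" "\<And>s. s \<notin> K \<Longrightarrow> cmod (f s) < \<epsilon> / cmod c"
      using vanishes_at_infinityD[OF assms] by blast
    then show "\<exists>K. compact K \<and> (\<forall>s. s \<notin> K \<longrightarrow> cmod (c * f s) < \<epsilon>)"
      using False by (auto simp: norm_mult field_simps intro!: exI[of _ K])
  qed
qed (simp add: vanishes_at_infinity_zero)

lemma subspace_vanishing_coefficients:
  assumes U: "\<And>s. unitary_operator (U s)"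
  shows "subspace {\<zeta>. vanishes_at_infinity (\<lambda>s. cinner (U s \<zeta>) \<eta>)}"
  by (rule subspaceI)
    (auto simp: linear_0 linear_add linear_scale unitary_operator_linear[OF U]
      cinner_zero_left cinner_add_left cinner_scaleR_left
      intro: vanishes_at_infinity_zero vanishes_at_infinity_add vanishes_at_infinity_scale)

text \<open>
  The isometric operators \<open>U s\<close> make the coefficients of nearby vectors uniformly close in \<open>s\<close>.
\<close>

lemma closed_vanishing_coefficients:
  assumes U: "\<And>s. unitary_operator (U s)"
  shows "closed {\<zeta>. vanishes_at_infinity (\<lambda>s. cinner (U s \<zeta>) \<eta>)}" (is "closed ?M")
proof -
  have "\<zeta> \<in> ?M" if cl: "\<zeta> \<in> closure ?M" for \<zeta>
    unfolding mem_Collect_eq vanishes_at_infinity_def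
  proof (intro allI impI)
    fix \<epsilon> :: real assume e: "\<epsilon> > 0"
    \<comment> \<open>the summand \<open>1\<close> keeps the denominator positive when \<open>\<eta> = 0\<close>\<close>
    define \<delta> where "\<delta> = \<epsilon> / (2 * (norm \<eta> + 1))"
    have pos: "norm \<eta> + 1 > 0" using norm_ge_zero[of \<eta>] by linarith
    then have "\<delta> > 0" using e by (simp add: \<delta>_def)
    with cl obtain \<zeta>' where \<zeta>': "\<zeta>' \<in> ?M" "dist \<zeta>' \<zeta> < \<delta>"
      unfolding closure_approachable by blast
    have "\<epsilon>/2 > 0" using e by simp
    then obtain K where K: "compact K" "\<And>s. s \<notin> K \<Longrightarrow> cmod (cinner (U s \<zeta>') \<eta>) < \<epsilon>/2"
      using vanishes_at_infinityD[of "\<lambda>s. cinner (U s \<zeta>') \<eta>"] \<zeta>'(1) by blast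
    have "cmod (cinner (U s \<zeta>) \<eta>) < \<epsilon>" if "s \<notin> K" for s
    proof -
      have "cinner (U s \<zeta>) \<eta> = cinner (U s (\<zeta> - \<zeta>')) \<eta> + cinner (U s \<zeta>') \<eta>"
        by (simp add: linear_diff unitary_operator_linear[OF U] cinner_diff_left)
      then have "cmod (cinner (U s \<zeta>) \<eta>)
          \<le> cmod (cinner (U s (\<zeta> - \<zeta>')) \<eta>) + cmod (cinner (U s \<zeta>') \<eta>)"
        using norm_triangle_ineq by metis
      moreover have "cmod (cinner (U s (\<zeta> - \<zeta>')) \<eta>) \<le> norm (\<zeta> - \<zeta>') * norm \<eta>"
        using cinner_Cauchy_Schwarz[of "U s (\<zeta> - \<zeta>')" \<eta>]
        by (simp add: unitary_operator_norm[OF U])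
      moreover have "norm (\<zeta> - \<zeta>') * norm \<eta> \<le> \<delta> * (norm \<eta> + 1)"
        using \<zeta>'(2) \<open>\<delta> > 0\<close> by (intro mult_mono) (auto simp: dist_norm norm_minus_commute)
      moreover have "\<delta> * (norm \<eta> + 1) = \<epsilon>/2"
        using pos by (simp add: \<delta>_def divide_simps)
      ultimately show ?thesis using K(2)[OF that] by linarith
    qed
    with K(1) show "\<exists>K. compact K \<and> (\<forall>s. s \<notin> K \<longrightarrow> cmod (cinner (U s \<zeta>) \<eta>) < \<epsilon>)" by blast
  qed
  then have "closure ?M \<subseteq> ?M" by blast
  then show ?thesis by (simp add: closure_subset_eq)
qed

text \<open>
  Moving \<open>\<pi> (\<alpha> s a)\<close> to the other side of the inner product leaves a bound in which \<open>U s\<close> enters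
  only through \<open>\<parallel>U s \<xi>\<parallel> = \<parallel>\<xi>\<parallel>\<close>; squaring turns the remaining factor into a vector functional
  evaluated on the orbit of \<open>a * star a\<close>.
\<close>

lemma covariant_coefficient_bound:
  assumes \<pi>: "representation \<pi>" and U: "unitary_operator V"
    and f: "cstar_automorphism f" and cov: "V \<circ> \<pi> a \<circ> cadjoint V = \<pi> (f a)"
  shows "(cmod (cinner (V (\<pi> a \<xi>)) \<eta>))\<^sup>2
    \<le> (norm \<xi>)\<^sup>2 * cmod (cinner (\<pi> (f (a * star a)) \<eta>) \<eta>)"
proof -
  have "V (\<pi> a \<xi>) = \<pi> (f a) (V \<xi>)"
    using fun_cong[OF cov, of "V \<xi>"] by (simp add: unitary_operator_cadjoint[OF U])
  then have "cinner (V (\<pi> a \<xi>)) \<eta> = cinner (V \<xi>) (\<pi> (star (f a)) \<eta>)"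
    using \<pi> unfolding representation_def is_cadjoint_def by simp
  then have "cmod (cinner (V (\<pi> a \<xi>)) \<eta>) \<le> norm \<xi> * norm (\<pi> (star (f a)) \<eta>)"
    using cinner_Cauchy_Schwarz[of "V \<xi>"] by (simp add: unitary_operator_norm[OF U])
  then have "(cmod (cinner (V (\<pi> a \<xi>)) \<eta>))\<^sup>2 \<le> (norm \<xi> * norm (\<pi> (star (f a)) \<eta>))\<^sup>2"
    by (rule power_mono) simp
  moreover have "f (a * star a) = star (star (f a)) * star (f a)"
    using f by (simp add: cstar_automorphism_def star_star)
  then have "cmod (cinner (\<pi> (f (a * star a)) \<eta>) \<eta>) = (norm (\<pi> (star (f a)) \<eta>))\<^sup>2"
    by (simp only: representation_norm_sq[OF \<pi>] norm_of_real abs_power2)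
  ultimately show ?thesis by (simp add: power_mult_distrib)
qed

theorem proposition4p10:
  fixes \<alpha> :: "'g::locally_compact_group \<Rightarrow> 'a::cstar_algebra \<Rightarrow> 'a"
    and \<pi> :: "'a \<Rightarrow> 'h::complex_hilbert_space \<Rightarrow> 'h"
    and U :: "'g \<Rightarrow> 'h \<Rightarrow> 'h"
  assumes "group_action \<alpha>" and "w_proper \<alpha>"
    and "representation \<pi>" and "nondegenerate \<pi>"
    and "\<And>s. unitary_operator (U s)"
    and "\<And>s a. U s \<circ> \<pi> a \<circ> cadjoint (U s) = \<pi> (\<alpha> s a)"
  shows "\<forall>\<xi> \<eta>. vanishes_at_infinity (\<lambda>s. cinner (U s \<xi>) \<eta>)"
proof (intro allI)
  fix \<xi> \<eta> :: 'h
  let ?M = "{\<zeta>. vanishes_at_infinity (\<lambda>s. cinner (U s \<zeta>) \<eta>)}"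
  have "\<pi> a \<zeta> \<in> ?M" for a \<zeta>
  proof -
    have "(\<lambda>s. cinner (\<pi> (\<alpha> s (a * star a)) \<eta>) \<eta>) \<in> C0"
      by (rule bspec[OF spec[OF assms(2)[unfolded w_proper_def]]
            vector_functional_in_dual_space[OF assms(3), of \<eta> \<eta>]])
    then have "vanishes_at_infinity (\<lambda>s. cinner (\<pi> (\<alpha> s (a * star a)) \<eta>) \<eta>)"
      by (simp add: C0_def)
    moreover have "(cmod (cinner (U s (\<pi> a \<zeta>)) \<eta>))\<^sup>2
        \<le> (norm \<zeta>)\<^sup>2 * cmod (cinner (\<pi> (\<alpha> s (a * star a)) \<eta>) \<eta>)" for s
      using assms(1) unfolding group_action_def
      by (intro covariant_coefficient_bound assms(3,5,6)) auto
    ultimately show ?thesis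
      unfolding mem_Collect_eq by (rule vanishes_at_infinity_sq_dominated)
  qed
  then have "span {\<pi> a \<zeta> | a \<zeta>. True} \<subseteq> ?M"
    by (intro span_minimal subspace_vanishing_coefficients assms(5)) auto
  then have "closure (span {\<pi> a \<zeta> | a \<zeta>. True}) \<subseteq> ?M"
    by (intro closure_minimal closed_vanishing_coefficients assms(5))
  then show "vanishes_at_infinity (\<lambda>s. cinner (U s \<xi>) \<eta>)"
    using assms(4) unfolding nondegenerate_def by blast
qed

end
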